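(* Let $(X,\mathcal{F},\mu)$ be a measure space with atomless, $\sigma$-finite, non-zero measure $\mu$, and let $N$ be a Young-Orlicz function. Let $$Y(N)=\sup_{0\neq f\in wL(N)}\frac{\|f\|_{sL(N)}}{\|f\|_{wL(N)}},\qquad J(N)=\inf_{C>0}\int_0^\infty N(Ct)\,|dV_N(t)| .$$ Then the strong and weak Luxemburg-Orlicz norms are equivalent, i.e. $Y(N)<\infty$, if and only if $$J(N)<\infty,$$ or equivalently, if and only if there exists $C=C[N]\in(0,\infty)$ such that $$\int_0^\infty N(Ct)\,|dV_N(t)|<\infty .$$
   Context: A Young-Orlicz function is a function $N:\mathbb{R}\to[0,\infty)$ that is even, continuous, convex, strictly increasing to infinity on $[0,\infty)$, with $\lim_{u\to0}N(u)/u=0$ and $\lim_{u\to\infty}N(u)/u=+\infty$; in particular $N(u)=0$ iff $u=0$. $M_0(X,\mu)$ is the set of all measurable functions $f:X\to\mathbb{R}$ finite almost everywhere (functions equal a.e. are identified, so $f\ne0$ means $f$ is not a.e. zero). For $f\in M_0(X,\mu)$ the tail function is $T[f](t)=\mu\{x:|f(x)|\ge t\}$, $t\ge0$. Strong (Luxemburg) norm: $\|f\|_{sL(N)}=\inf\{k>0:\int_X N(|f(x)|/k)\,d\mu(x)\le1\}$, with value $+\infty$ if no such $k$ exists. $V_N(t)=\min\left(\mu(X),\frac1{N(t)}\right)$, $t\ge0$, with the conventions $1/N(0)=\infty$ and $\min(c,\infty)=c$ (the measure $\mu(X)$ may be infinite). Weak norm: $\|f\|_{wL(N)}=\inf\{K>0:\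 T[f](t)\le V_N(t/K)\ \text{for all } t>0\}$, with value $+\infty$ if no such $K$ exists. The weak Orlicz space $wL(N)$ is the set of $f\in M_0(X,\mu)$ with $\|f\|_{wL(N)}<\infty$. $V_N$ is non-increasing, and $|dV_N(t)|=-dV_N(t)$ denotes the associated positive Lebesgue-Stieltjes measure on $(0,\infty)$. Explicitly, if $t_0\in[0,\infty)$ is the unique value with $N(t_0)=1/\mu(X)$ (so $t_0=0$ if $\mu(X)=\infty$), then $\int_0^\infty N(Ct)\,|dV_N(t)|=-\int_{t_0}^\infty N(Ct)\,d\left[\frac1{N(t)}\right]$. *)

theory Defs
  imports "HOL-Analysis.Analysis"
begin

definition Young_Orlicz :: "(real \<Rightarrow> real) \<Rightarrow> bool" where
  "Young_Orlicz N \<longleftrightarrow>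
     (\<forall>u. 0 \<le> N u) \<and> (\<forall>u. N (- u) = N u) \<and>
     continuous_on UNIV N \<and> convex_on UNIV N \<and>
     strict_mono_on {0..} N \<and> filterlim N at_top at_top \<and>
     ((\<lambda>u. N u / u) \<longlongrightarrow> 0) (at 0) \<and>
     filterlim (\<lambda>u. N u / u) at_top at_top"

definition atomless :: "'a measure \<Rightarrow> bool" where
  "atomless M \<longleftrightarrow>
     (\<forall>A\<in>sets M. 0 < emeasure M A \<longrightarrow>
        (\<exists>B\<in>sets M. B \<subseteq> A \<and> 0 < emeasure M B \<and> emeasure M B < emeasure M A))"

definition tail_fun :: "'a measure \<Rightarrow> ('a \<Rightarrow> real) \<Rightarrow> real \<Rightarrow> ennreal" where
  "tail_fun M f t = emeasure M {x \<in> space M. t \<le> \<bar>f x\<bar>}"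

text \<open>
  Both norms take values in \<open>[0, \<infinity>]\<close>; the infimum of the empty set is \<open>\<infinity>\<close>.
\<close>

definition strong_norm :: "'a measure \<Rightarrow> (real \<Rightarrow> real) \<Rightarrow> ('a \<Rightarrow> real) \<Rightarrow> ennreal" where
  "strong_norm M N f =
     (INF k \<in> {k :: real. 0 < k \<and> (\<integral>\<^sup>+ x. ennreal (N (\<bar>f x\<bar> / k)) \<partial>M) \<le> 1}. ennreal k)"

text \<open>In type \<^typ>\<open>ennreal\<close>, \<open>inverse 0 = \<infinity>\<close>, which is the convention \<open>1/N(0) = \<infinity>\<close>.\<close>

definition V_fun :: "'a measure \<Rightarrow> (real \<Rightarrow> real) \<Rightarrow> real \<Rightarrow> ennreal" where
  "V_fun M N t = min (emeasure M (space M)) (inverse (ennreal (N t)))"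

definition weak_norm :: "'a measure \<Rightarrow> (real \<Rightarrow> real) \<Rightarrow> ('a \<Rightarrow> real) \<Rightarrow> ennreal" where
  "weak_norm M N f =
     (INF K \<in> {K :: real. 0 < K \<and> (\<forall>t>0. tail_fun M f t \<le> V_fun M N (t / K))}. ennreal K)"

definition weak_Orlicz :: "'a measure \<Rightarrow> (real \<Rightarrow> real) \<Rightarrow> ('a \<Rightarrow> real) set" where
  "weak_Orlicz M N = {f \<in> borel_measurable M. weak_norm M N f < \<infinity>}"

definition Y_const :: "'a measure \<Rightarrow> (real \<Rightarrow> real) \<Rightarrow> ennreal" where
  "Y_const M N =
     (SUP f \<in> {f \<in> weak_Orlicz M N. \<not> (AE x in M. f x = 0)}. strong_norm M N f / weak_norm M N f)"

text \<open>
  The positive Lebesgue-Stieltjes measure \<open>|dV|\<close> on \<open>(0, \<infinity>)\<close>: the measure on the sigma-algebra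
  generated by the half-open intervals with \<open>|dV| (a, b] = V(a) - V(b)\<close> for \<open>0 < a \<le> b\<close>.
  This is the construction of \<^const>\<open>interval_measure\<close>, carried out on \<open>(0, \<infinity>)\<close> because
  \<open>V(t)\<close> may tend to infinity as \<open>t\<close> tends to \<open>0\<close>.
\<close>

definition dV_measure :: "'a measure \<Rightarrow> (real \<Rightarrow> real) \<Rightarrow> real measure" where
  "dV_measure M N =
     extend_measure {0<..} {(a, b). 0 < a \<and> a \<le> b} (\<lambda>(a, b). {a<..b})
       (\<lambda>(a, b). V_fun M N a - V_fun M N b)"

lemma sets_dV_measure:
  "sets (dV_measure M N) = sigma_sets {0<..} ((\<lambda>(a, b). {a<..b}) ` {(a, b). 0 < a \<and> a \<le> b})"
  unfolding dV_measure_def by (rule sets_extend_measure) auto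

lemma space_dV_measure: "space (dV_measure M N) = {0<..}"
  unfolding dV_measure_def by (rule space_extend_measure) auto

lemma Young_Orlicz_pos:
  assumes "Young_Orlicz N" "0 < t"
  shows "0 < N t"
proof -
  have "0 \<le> N 0" "strict_mono_on {0..} N"
    using assms(1) by (auto simp: Young_Orlicz_def)
  moreover have "N 0 < N t"
    using strict_mono_onD[OF calculation(2), of 0 t] assms(2) by auto
  ultimately show ?thesis by linarith
qed

lemma Young_Orlicz_zero:
  assumes "Young_Orlicz N"
  shows "N 0 = 0"
proof -
  have lim: "((\<lambda>u. N u / u) \<longlongrightarrow> 0) (at 0)" and cont: "isCont N 0"
    using assms continuous_on_eq_continuous_at[of UNIV N] by (auto simp: Young_Orlicz_def)
  have "((\<lambda>u. N u / u * u) \<longlongrightarrow> 0 * 0) (at 0)"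
    by (intro tendsto_mult lim tendsto_ident_at)
  then have "(N \<longlongrightarrow> 0) (at 0)"
    by (rule filterlim_cong[THEN iffD1, rotated 3]) (auto simp: eventually_at_filter)
  with cont show ?thesis
    using LIM_unique isCont_def by blast
qed

text \<open>The Lebesgue-Stieltjes measure exists, so \<^const>\<open>dV_measure\<close> is not a junk value.\<close>

lemma emeasure_dV_measure:
  assumes N: "Young_Orlicz N" and ab: "0 < a" "a \<le> b"
  shows "emeasure (dV_measure M N) {a<..b} = V_fun M N a - V_fun M N b"
proof -
  let ?c = "emeasure M (space M)" and ?D = "dV_measure M N"
  define S where "S = {s :: real. 0 < s \<and> ennreal s < ?c}"
  have pos: "0 < N t" if "0 < t" for t by (rule Young_Orlicz_pos[OF N that])
  have mono: "N x < N y \<longleftrightarrow> x < y" if "0 < x" "0 < y" for x y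
    using N that strict_mono_onD[of "{0..}" N x y] strict_mono_onD[of "{0..}" N y x]
    unfolding Young_Orlicz_def by (cases x y rule: linorder_cases) force+
  have ex: "\<exists>t>0. N t = 1 / s" if s: "0 < s" for s
  proof -
    have "filterlim N at_top at_top" "continuous_on UNIV N"
      using N by (auto simp: Young_Orlicz_def)
    then have "eventually (\<lambda>t. 1 / s \<le> N t) at_top"
      by (simp add: filterlim_at_top)
    then have "eventually (\<lambda>t. 1 / s \<le> N t \<and> 0 < t) at_top"
      using eventually_gt_at_top[of "0::real"] by (rule eventually_conj)
    then obtain T where T: "1 / s \<le> N T" "0 < T"
      by (auto dest: eventually_happens)
    moreover have "continuous_on {0..T} N"
      using \<open>continuous_on UNIV N\<close> by (rule continuous_on_subset) auto
    ultimately obtain t where t: "0 \<le> t" "N t = 1 / s"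
      using IVT'[of N 0 "1 / s" T] Young_Orlicz_zero[OF N] s by (auto simp: less_imp_le)
    then have "t \<noteq> 0" using Young_Orlicz_zero[OF N] s by auto
    with t show ?thesis by (intro exI[of _ t]) auto
  qed
  define g where "g s = (SOME t. 0 < t \<and> N t = 1 / s)" for s
  have g: "0 < g s" "N (g s) = 1 / s" if "0 < s" for s
    using someI_ex[OF ex[OF that, simplified]] unfolding g_def by auto
  have g_iff: "g s \<in> {a<..b} \<longleftrightarrow> 1 / N b \<le> s \<and> s < 1 / N a"
    if "0 < s" "0 < a" "a \<le> b" for s a b
  proof -
    have "a < g s \<longleftrightarrow> N a < 1 / s" using mono[of a "g s"] g[of s] that by simp
    moreover have "g s \<le> b \<longleftrightarrow> 1 / s \<le> N b" using mono[of b "g s"] g[of s] that by force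
    ultimately show ?thesis using pos[of a] pos[of b] that by (auto simp: field_simps)
  qed
  have S_sets: "S \<in> sets lborel"
    unfolding S_def by measurable
  have pre: "{s \<in> S. g s \<in> {a<..b}} = S \<inter> {1 / N b..<1 / N a}" if "0 < a" "a \<le> b" for a b
    using g_iff[OF _ that] unfolding S_def atLeastLessThan_iff[symmetric] by blast
  have g_meas: "g \<in> measurable (restrict_space lborel S) ?D"
  proof (rule measurable_sigma_sets[OF sets_dV_measure])
    show "(\<lambda>(a, b). {a<..b}) ` {(a, b). 0 < a \<and> a \<le> b} \<subseteq> Pow {0::real<..}" by auto
    show "g \<in> space (restrict_space lborel S) \<rightarrow> {0<..}"
      using g by (auto simp: S_def space_restrict_space)
    fix A :: "real set" assume "A \<in> (\<lambda>(a, b). {a<..b}) ` {(a, b). 0 < a \<and> a \<le> b}"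
    then obtain a b where A: "A = {a<..b}" "0 < a" "a \<le> b" by auto
    have "g -` A \<inter> space (restrict_space lborel S) = {s \<in> S. g s \<in> {a<..b}}"
      unfolding A(1) space_restrict_space by auto
    also have "\<dots> = S \<inter> {1 / N b..<1 / N a}"
      by (rule pre[OF A(2,3)])
    also have "\<dots> \<in> sets (restrict_space lborel S)"
      by (auto simp: sets_restrict_space)
    finally show "g -` A \<inter> space (restrict_space lborel S) \<in> sets (restrict_space lborel S)" .
  qed
  let ?\<nu> = "distr (restrict_space lborel S) ?D g"
  have val: "emeasure ?\<nu> {a<..b} = V_fun M N a - V_fun M N b" if ab: "0 < a" "a \<le> b" for a b
  proof -
    have "{a<..b} \<in> sets ?D"
      unfolding sets_dV_measure using ab by (intro sigma_sets.Basic) auto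
    then have "emeasure ?\<nu> {a<..b} =
        emeasure (restrict_space lborel S) (g -` {a<..b} \<inter> space (restrict_space lborel S))"
      by (rule emeasure_distr[OF g_meas])
    also have "g -` {a<..b} \<inter> space (restrict_space lborel S) = {s \<in> S. g s \<in> {a<..b}}"
      unfolding space_restrict_space by auto
    also have "\<dots> = S \<inter> {1 / N b..<1 / N a}"
      by (rule pre[OF ab])
    also have "emeasure (restrict_space lborel S) (S \<inter> {1 / N b..<1 / N a}) =
        emeasure lborel (S \<inter> {1 / N b..<1 / N a})"
      using S_sets by (intro emeasure_restrict_space) auto
    also have "\<dots> = V_fun M N a - V_fun M N b"
    proof -
      have N: "0 < N a" "N a \<le> N b" using pos mono[of b a] ab by (auto simp: not_less[symmetric])
      then have le: "1 / N b \<le> 1 / N a" "0 < 1 / N b" by (auto simp: field_simps)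
      have px: "0 < x" if "1 / N b \<le> x" for x
        using le that by linarith
      have V: "V_fun M N t = min ?c (ennreal (1 / N t))" if "0 < t" for t
        using pos[OF that] by (simp add: V_fun_def inverse_ennreal inverse_eq_divide)
      show ?thesis
      proof (cases ?c)
        case (real r)
        have "S \<inter> {1 / N b..<1 / N a} = {1 / N b..<min r (1 / N a)}"
          using real by (auto simp: S_def ennreal_less_iff less_imp_le px)
        moreover have "V_fun M N a = ennreal (min r (1 / N a))" "V_fun M N b = ennreal (min r (1 / N b))"
          using V real ab N le by (auto simp: min_def ennreal_le_iff2)
        ultimately show ?thesis
          using le real by (cases "1 / N b \<le> r") (auto simp: ennreal_minus min_def)
      next
        case top
        have "S \<inter> {1 / N b..<1 / N a} = {1 / N b..<1 / N a}"
          using top by (auto simp: S_def less_top[symmetric] px)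
        then show ?thesis
          using le top V ab by (simp add: ennreal_minus)
      qed
    qed
    finally show ?thesis .
  qed
  have "positive (sets ?\<nu>) (emeasure ?\<nu>)" "countably_additive (sets ?\<nu>) (emeasure ?\<nu>)"
    by (rule emeasure_positive, rule emeasure_countably_additive)
  then show ?thesis
    by (intro emeasure_extend_measure_Pair[OF dV_measure_def, of "emeasure ?\<nu>"])
       (use val ab in auto)
qed

definition V_integral :: "'a measure \<Rightarrow> (real \<Rightarrow> real) \<Rightarrow> real \<Rightarrow> ennreal" where
  "V_integral M N C = (\<integral>\<^sup>+ t. ennreal (N (C * t)) \<partial>dV_measure M N)"

definition J_const :: "'a measure \<Rightarrow> (real \<Rightarrow> real) \<Rightarrow> ennreal" where
  "J_const M N = (INF C \<in> {0<..}. V_integral M N C)"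

end

theory Submission
  imports Defs
begin

text \<open>
  Write \<open>\<nu> = |dV\<^sub>N|\<close>. Since \<open>V\<^sub>N\<close> decreases to \<open>0\<close> at infinity, \<open>\<nu> (t, \<infinity>) = V\<^sub>N t\<close>: the identity
  on \<open>((0, \<infinity>), \<nu>)\<close> has tail \<open>V\<^sub>N\<close>, which is the largest tail that a function of weak norm at most
  \<open>1\<close> can have. Both directions compare a function on \<open>X\<close> with this extremal one, through the fact
  that integrals are monotone in tails (\<open>nn_integral_mono_tails\<close>, from the layer-cake formula).

  If \<open>\<integral> N (C t) d\<nu> < \<infinity>\<close>, convexity and \<open>N 0 = 0\<close> allow \<open>C\<close> to be shrunk to some \<open>c\<close> for which the
  integral is at most \<open>1\<close> (\<open>V_integral_le_1\<close>). For \<open>K\<close> above the weak norm of \<open>f\<close> the tail of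
  \<open>|f| / K\<close> is below \<open>V\<^sub>N\<close>, so \<open>\<integral> N (c |f| / K) d\<mu> \<le> 1\<close>; hence the strong norm is at most
  \<open>1 / c\<close> times the weak norm.

  Conversely, suppose that every such integral is infinite. One function with an infinite ratio is
  enough, and a tail equal to \<open>V\<^sub>N\<close> is not needed: it suffices that the tail lies between
  \<open>V\<^sub>N (2 t)\<close> and \<open>V\<^sub>N t\<close> (\<open>ex_function_with_tail_near_V_fun\<close>). Round \<open>t\<close> down to a power of two:
  this step function on \<open>(0, \<infinity>)\<close> takes countably many values, so a copy of it on \<open>X\<close> only
  requires disjoint sets whose measures are the \<open>\<nu>\<close>-masses of the dyadic intervals. They exist
  because \<open>\<mu>\<close> is atomless and the total mass of \<open>\<nu>\<close> is at most \<open>\<mu> X\<close>. The copy has weak norm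
  at most \<open>1\<close>, and all its Orlicz integrals dominate some \<open>\<integral> N (C t) d\<nu> = \<infinity>\<close>.
\<close>

section \<open>Atomless measures\<close>

text \<open>
  If the infimum \<open>i\<close> of the positive measures of subsets of \<open>A\<close> were positive, a subset of measure
  less than \<open>2 i\<close> could not be split into two parts of positive measure. So \<open>i = 0\<close>.
\<close>

lemma atomless_small_subset:
  assumes "atomless M" "A \<in> sets M" "0 < emeasure M A" "0 < e"
  obtains C where "C \<in> sets M" "C \<subseteq> A" "0 < emeasure M C" "emeasure M C \<le> e"
proof -
  let ?S = "{C \<in> sets M. C \<subseteq> A \<and> 0 < emeasure M C}"
  define i where "i = (INF C\<in>?S. emeasure M C)"
  obtain B where B: "B \<in> sets M" "B \<subseteq> A" "0 < emeasure M B" "emeasure M B < emeasure M A"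
    using assms unfolding atomless_def by blast
  have "i \<le> emeasure M B"
    unfolding i_def using B by (intro INF_lower) auto
  then have fin: "i < \<infinity>"
    using order.strict_trans1[OF _ order.strict_trans2[OF B(4) top_greatest]] by simp
  show thesis
  proof (cases "i < e")
    case True
    then obtain C where "C \<in> ?S" "emeasure M C < e"
      unfolding i_def INF_less_iff by blast
    then show ?thesis using that[of C] by auto
  next
    case False
    then have "0 < i" using assms(4) by (meson less_le_trans not_less)
    then have "i < i + i" using fin ennreal_add_left_cancel_less[of i 0 i] by simp
    then obtain C where C: "C \<in> sets M" "C \<subseteq> A" "0 < emeasure M C" "emeasure M C < i + i"
      unfolding i_def INF_less_iff by blast
    obtain D where D: "D \<in> sets M" "D \<subseteq> C" "0 < emeasure M D" "emeasure M D < emeasure M C"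
      using assms(1) C unfolding atomless_def by blast
    have sum: "emeasure M C = emeasure M D + emeasure M (C - D)"
      using C D by (subst plus_emeasure) (auto simp: Un_absorb1)
    then have "0 < emeasure M (C - D)"
      using D(4) by (metis add.right_neutral less_irrefl zero_less_iff_neq_zero)
    then have "i \<le> emeasure M D" "i \<le> emeasure M (C - D)"
      unfolding i_def using C D by (auto intro!: INF_lower)
    then have "i + i \<le> emeasure M C"
      unfolding sum by (rule add_mono)
    then show ?thesis using C(4) by simp
  qed
qed

text \<open>
  Sierpinski's theorem, by exhaustion: among the supersets of \<open>U\<close> of measure at most \<open>b\<close> there is
  one of maximal measure, and if it fell short of \<open>b\<close>, a small piece of its complement could be added.
\<close>

lemma atomless_extend_to_measure:
  assumes M: "atomless M" and U: "U \<in> sets M" "emeasure M U \<le> b"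
    and b: "b \<le> emeasure M (space M)" "b < \<infinity>"
  obtains W where "W \<in> sets M" "U \<subseteq> W" "emeasure M W = b"
proof -
  define P where "P B \<longleftrightarrow> B \<in> sets M \<and> U \<subseteq> B \<and> emeasure M B \<le> b" for B
  \<comment> \<open>Each step comes within \<open>1 / (n + 1)\<close> of the supremum over all admissible supersets of \<open>B\<close>;
    therefore the union of the resulting chain has maximal measure.\<close>
  have step: "\<exists>B'. P B' \<and> B \<subseteq> B' \<and> (\<forall>C. P C \<and> B \<subseteq> C \<longrightarrow> emeasure M C \<le> emeasure M B' + ennreal (1 / Suc n))"
    if B: "P B" for B n
  proof (rule ccontr)
    let ?e = "ennreal (1 / Suc n)"
    define s where "s = (SUP C\<in>{C. P C \<and> B \<subseteq> C}. emeasure M C)"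
    assume "\<not> ?thesis"
    then have *: "\<exists>C. P C \<and> B \<subseteq> C \<and> emeasure M B' + ?e < emeasure M C" if "P B'" "B \<subseteq> B'" for B'
      using that by (meson not_less)
    have "s + ?e = (SUP C\<in>{C. P C \<and> B \<subseteq> C}. emeasure M C + ?e)"
      unfolding s_def using B by (subst ennreal_SUP_add_left) auto
    also have "\<dots> \<le> s"
    proof (rule SUP_least)
      fix B' assume "B' \<in> {C. P C \<and> B \<subseteq> C}"
      then obtain C where "P C" "B \<subseteq> C" "emeasure M B' + ?e < emeasure M C"
        using * by blast
      moreover from this have "emeasure M C \<le> s"
        unfolding s_def by (intro SUP_upper) auto
      ultimately show "emeasure M B' + ?e \<le> s" by simp
    qed
    finally have le: "s + ?e \<le> s" .
    have "s \<le> b" unfolding s_def by (rule SUP_least) (auto simp: P_def)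
    then have "s < \<infinity>" using b(2) by (rule le_less_trans)
    moreover have "0 < ?e" by simp
    ultimately have "s < s + ?e"
      using ennreal_add_left_cancel_less[of s 0 ?e] by simp
    with le show False by simp
  qed
  obtain F where F: "\<And>n. P (F n)" "\<And>n. F n \<subseteq> F (Suc n)"
      "\<And>n C. P C \<Longrightarrow> F n \<subseteq> C \<Longrightarrow> emeasure M C \<le> emeasure M (F (Suc n)) + ennreal (1 / Suc n)"
  proof -
    have "P U" using U by (simp add: P_def)
    then have "\<exists>F. \<forall>n. P (F n) \<and> F n \<subseteq> F (Suc n) \<and>
        (\<forall>C. P C \<and> F n \<subseteq> C \<longrightarrow> emeasure M C \<le> emeasure M (F (Suc n)) + ennreal (1 / Suc n))"
      by (intro dependent_nat_choice step exI)
    with that show thesis by blast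
  qed
  define W where "W = (\<Union>n. F n)"
  have inc: "incseq F" using F(2) by (rule incseq_SucI)
  have "W \<in> sets M" "U \<subseteq> W" using F(1) unfolding W_def P_def by auto
  moreover have "emeasure M W \<le> b"
    unfolding W_def using F(1) inc by (subst SUP_emeasure_incseq[symmetric]) (auto simp: P_def intro!: SUP_least)
  ultimately have W: "P W" by (simp add: P_def)
  have maximal: "emeasure M C \<le> emeasure M W" if "P C" "W \<subseteq> C" for C
  proof (rule LIMSEQ_le_const)
    have "(\<lambda>n. ennreal (1 / Suc n)) \<longlonglongrightarrow> ennreal 0"
      by (intro tendsto_ennrealI LIMSEQ_inverse_real_of_nat[unfolded inverse_eq_divide])
    then show "(\<lambda>n. emeasure M W + ennreal (1 / Suc n)) \<longlonglongrightarrow> emeasure M W"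
      using tendsto_add[OF tendsto_const[of "emeasure M W"]] by fastforce
    have "emeasure M C \<le> emeasure M W + ennreal (1 / Suc n)" for n
    proof -
      have "emeasure M C \<le> emeasure M (F (Suc n)) + ennreal (1 / Suc n)"
        using that by (intro F(3)) (auto simp: W_def)
      also have "emeasure M (F (Suc n)) \<le> emeasure M W"
        using W by (intro emeasure_mono) (auto simp: W_def P_def)
      finally show ?thesis by simp
    qed
    then show "\<exists>N. \<forall>n\<ge>N. emeasure M C \<le> emeasure M W + ennreal (1 / Suc n)" by blast
  qed
  have "emeasure M W = b"
  proof (rule ccontr)
    assume "emeasure M W \<noteq> b"
    with W have lt: "emeasure M W < b" by (auto simp: P_def)
    have "emeasure M W + emeasure M (space M - W) = emeasure M (space M)"
      using W sets.sets_into_space[of W M] by (subst plus_emeasure) (auto simp: P_def Un_absorb1)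
    then have "0 < emeasure M (space M - W)"
      using lt b(1) by (metis add.right_neutral less_le_trans not_less_iff_gr_or_eq zero_less_iff_neq_zero)
    moreover have "0 < b - emeasure M W"
      using lt by (simp add: diff_gr0_ennreal)
    moreover have "space M - W \<in> sets M"
      using W by (auto simp: P_def)
    ultimately obtain C where C: "C \<in> sets M" "C \<subseteq> space M - W" "0 < emeasure M C" "emeasure M C \<le> b - emeasure M W"
      using atomless_small_subset[OF M] by metis
    have eq: "emeasure M (W \<union> C) = emeasure M W + emeasure M C"
      using C W by (subst plus_emeasure) (auto simp: P_def)
    also have "\<dots> \<le> emeasure M W + (b - emeasure M W)"
      using C(4) by (rule add_left_mono)
    also have "\<dots> = b"
      using lt by (simp add: add_diff_inverse_ennreal less_imp_le)
    finally have "P (W \<union> C)"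
      using W C by (auto simp: P_def)
    then have "emeasure M W + emeasure M C \<le> emeasure M W"
      using maximal[of "W \<union> C"] eq by simp
    moreover have "emeasure M W < \<infinity>" using lt b(2) by (rule less_trans)
    ultimately show False
      using C(3) by (metis add.right_neutral ennreal_add_left_cancel_le infinity_ennreal_def leD top.not_eq_extremum)
  qed
  with W that show thesis by (auto simp: P_def)
qed

text \<open>
  The sets are the differences of a chain whose \<open>n\<close>-th member has measure \<open>\<Sum>i<n. a i\<close>. Building a
  chain, rather than picking sets from what is left over, avoids subtracting from
  a space of possibly infinite measure.
\<close>

lemma atomless_disjoint_sets_of_measures:
  fixes a :: "nat \<Rightarrow> ennreal"
  assumes M: "atomless M" and fin: "\<And>n. a n < \<infinity>" and le: "(\<Sum>n. a n) \<le> emeasure M (space M)"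
  shows "\<exists>A. (\<forall>n. A n \<in> sets M) \<and> disjoint_family A \<and> (\<forall>n. emeasure M (A n) = a n)"
proof -
  have fin': "(\<Sum>i<n. a i) < \<infinity>" for n
    using fin by (simp add: less_top)
  have le': "(\<Sum>i<n. a i) \<le> emeasure M (space M)" for n
    using sum_le_suminf[of a "{..<n}"] le by (auto intro: order_trans)
  have "\<exists>U'. (U' \<in> sets M \<and> emeasure M U' = (\<Sum>i<Suc n. a i)) \<and> U \<subseteq> U'"
    if "U \<in> sets M \<and> emeasure M U = (\<Sum>i<n. a i)" for U n
    by (rule atomless_extend_to_measure[OF M, of U "\<Sum>i<Suc n. a i"]) (use that fin'[of "Suc n"] le'[of "Suc n"] in auto)
  moreover have "{} \<in> sets M \<and> emeasure M {} = (\<Sum>i<0. a i)" by simp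
  ultimately obtain U where U: "\<And>n. U n \<in> sets M" "\<And>n. emeasure M (U n) = (\<Sum>i<n. a i)"
      "\<And>n. U n \<subseteq> U (Suc n)"
    using dependent_nat_choice[of "\<lambda>n U. U \<in> sets M \<and> emeasure M U = (\<Sum>i<n. a i)" "\<lambda>n. (\<subseteq>)"]
    by metis
  have inc: "U m \<subseteq> U n" if "m \<le> n" for m n
    using U(3) that by (rule lift_Suc_mono_le)
  show ?thesis
  proof (intro exI[of _ "\<lambda>n. U (Suc n) - U n"] conjI allI)
    show "U (Suc n) - U n \<in> sets M" for n using U by auto
    show "disjoint_family (\<lambda>n. U (Suc n) - U n)"
      using inc by (intro disjoint_family_Suc) (auto intro: U)
    show "emeasure M (U (Suc n) - U n) = a n" for n
      using U fin'[of n] by (subst emeasure_Diff) (auto simp: less_top add.commute)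
  qed
qed

section \<open>Comparison of integrals by tails\<close>

text \<open>Tonelli's theorem for the region under the graph of \<open>F\<close>.\<close>

lemma nn_integral_layer_cake:
  fixes F :: "'a \<Rightarrow> real"
  assumes "sigma_finite_measure M" and [measurable]: "F \<in> borel_measurable M"
  shows "(\<integral>\<^sup>+ x. ennreal (F x) \<partial>M) = (\<integral>\<^sup>+ u. emeasure M {x \<in> space M. u < F x} * indicator {0<..} u \<partial>lborel)"
proof -
  interpret sigma_finite_measure M by fact
  interpret pair_sigma_finite M lborel ..
  have "(\<integral>\<^sup>+ x. ennreal (F x) \<partial>M) = (\<integral>\<^sup>+ x. \<integral>\<^sup>+ u. indicator {0<..} u * indicator {y. snd y < F (fst y)} (x, u) \<partial>lborel \<partial>M)"
  proof (rule nn_integral_cong)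
    fix x
    have "(\<integral>\<^sup>+ u. indicator {0<..} u * indicator {y. snd y < F (fst y)} (x, u) \<partial>lborel) = (\<integral>\<^sup>+ u. indicator {0<..<F x} u \<partial>lborel)"
      by (intro nn_integral_cong) (auto split: split_indicator)
    also have "\<dots> = ennreal (F x)"
      by (cases "0 \<le> F x") (auto simp: ennreal_neg)
    finally show "ennreal (F x) = (\<integral>\<^sup>+ u. indicator {0<..} u * indicator {y. snd y < F (fst y)} (x, u) \<partial>lborel)" ..
  qed
  also have "\<dots> = (\<integral>\<^sup>+ u. \<integral>\<^sup>+ x. indicator {0<..} u * indicator {y. snd y < F (fst y)} (x, u) \<partial>M \<partial>lborel)"
    by (rule Fubini'[symmetric]) (simp add: indicator_def, measurable)
  also have "\<dots> = (\<integral>\<^sup>+ u. emeasure M {x \<in> space M. u < F x} * indicator {0<..} u \<partial>lborel)"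
  proof (rule nn_integral_cong)
    fix u :: real
    have "(\<integral>\<^sup>+ x. indicator {0<..} u * indicator {y. snd y < F (fst y)} (x, u) \<partial>M)
        = (\<integral>\<^sup>+ x. indicator {0<..} u * indicator {x \<in> space M. u < F x} x \<partial>M)"
      by (intro nn_integral_cong) (auto split: split_indicator)
    also have "\<dots> = emeasure M {x \<in> space M. u < F x} * indicator {0<..} u"
      by (subst nn_integral_cmult_indicator) (auto simp: mult.commute)
    finally show "(\<integral>\<^sup>+ x. indicator {0<..} u * indicator {y. snd y < F (fst y)} (x, u) \<partial>M)
      = emeasure M {x \<in> space M. u < F x} * indicator {0<..} u" .
  qed
  finally show ?thesis .
qed

lemma nn_integral_mono_tails:
  fixes F :: "'a \<Rightarrow> real" and G :: "'b \<Rightarrow> real"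
  assumes "sigma_finite_measure M" "F \<in> borel_measurable M"
    and "sigma_finite_measure L" "G \<in> borel_measurable L"
    and "\<And>u. 0 < u \<Longrightarrow> emeasure M {x \<in> space M. u < F x} \<le> emeasure L {y \<in> space L. u < G y}"
  shows "(\<integral>\<^sup>+ x. ennreal (F x) \<partial>M) \<le> (\<integral>\<^sup>+ y. ennreal (G y) \<partial>L)"
  unfolding nn_integral_layer_cake[OF assms(1,2)] nn_integral_layer_cake[OF assms(3,4)]
  by (intro nn_integral_mono) (auto split: split_indicator intro: assms(5))

section \<open>Young--Orlicz functions\<close>

lemma Young_Orlicz_less_iff:
  assumes "Young_Orlicz N" "0 \<le> x" "0 \<le> y"
  shows "N x < N y \<longleftrightarrow> x < y"
  using assms strict_mono_onD[of "{0..}" N x y] strict_mono_onD[of "{0..}" N y x]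
  unfolding Young_Orlicz_def by (cases x y rule: linorder_cases) force+

lemma Young_Orlicz_measurable [measurable]:
  assumes "Young_Orlicz N" shows "N \<in> borel_measurable borel"
  using assms unfolding Young_Orlicz_def by (intro borel_measurable_continuous_onI) auto

text \<open>This turns the superlevel sets of \<open>N \<circ> g\<close> into superlevel sets of \<open>g\<close>.\<close>

lemma Young_Orlicz_inverse:
  assumes N: "Young_Orlicz N" and "0 < u"
  obtains s where "0 < s" "N s = u"
proof -
  have "filterlim N at_top at_top" "continuous_on UNIV N"
    using N by (auto simp: Young_Orlicz_def)
  then have "eventually (\<lambda>t. u \<le> N t \<and> 0 < t) at_top"
    by (intro eventually_conj eventually_gt_at_top) (simp add: filterlim_at_top)
  then obtain T where T: "u \<le> N T" "0 < T"
    by (auto dest: eventually_happens)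
  moreover have "continuous_on {0..T} N"
    using \<open>continuous_on UNIV N\<close> by (rule continuous_on_subset) auto
  ultimately obtain s where s: "0 \<le> s" "N s = u"
    using IVT'[of N 0 u T] Young_Orlicz_zero[OF N] \<open>0 < u\<close> by (auto simp: less_imp_le)
  then have "s \<noteq> 0" using Young_Orlicz_zero[OF N] \<open>0 < u\<close> by auto
  with s that[of s] show thesis by simp
qed

lemma Young_Orlicz_scale:
  assumes N: "Young_Orlicz N" and "0 \<le> e" "e \<le> 1"
  shows "N (e * x) \<le> e * N x"
proof -
  have "convex_on UNIV N" using N by (simp add: Young_Orlicz_def)
  from convex_onD[OF this, of e 0 x] show ?thesis
    using assms Young_Orlicz_zero[OF N] by simp
qed

section \<open>The measure \<open>|dV\<^sub>N|\<close>\<close>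

lemma V_fun_antimono:
  assumes "Young_Orlicz N" "0 \<le> s" "s \<le> t"
  shows "V_fun M N t \<le> V_fun M N s"
proof -
  have "N s \<le> N t" using Young_Orlicz_less_iff[of N t s] assms by auto
  moreover have "0 \<le> N s" using assms(1) by (simp add: Young_Orlicz_def)
  ultimately have "inverse (ennreal (N t)) \<le> inverse (ennreal (N s))"
    by (cases "N s = 0") (auto simp: inverse_ennreal intro!: ennreal_leI le_imp_inverse_le)
  then show ?thesis
    unfolding V_fun_def by (intro min.mono order_refl)
qed

lemma V_fun_finite:
  assumes "Young_Orlicz N" "0 < t"
  shows "V_fun M N t < \<infinity>"
  using Young_Orlicz_pos[OF assms] by (auto simp: V_fun_def min_less_iff_disj inverse_ennreal)

lemma V_fun_tendsto_0:
  assumes N: "Young_Orlicz N"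
  shows "(V_fun M N \<longlongrightarrow> 0) at_top"
proof (rule tendsto_sandwich[OF _ _ tendsto_const])
  have "filterlim N at_top at_top" using N by (simp add: Young_Orlicz_def)
  then have "((\<lambda>t. ennreal (inverse (N t))) \<longlongrightarrow> ennreal 0) at_top"
    by (intro tendsto_ennrealI tendsto_inverse_0_at_top)
  then show "((\<lambda>t. ennreal (inverse (N t))) \<longlongrightarrow> 0) at_top" by simp
  show "\<forall>\<^sub>F t in at_top. V_fun M N t \<le> ennreal (inverse (N t))"
    using eventually_gt_at_top[of "0::real"]
    by eventually_elim (simp add: V_fun_def inverse_ennreal Young_Orlicz_pos[OF N])
qed simp

lemma Ioc_in_sets_dV_measure:
  assumes "0 < a"
  shows "{a<..b} \<in> sets (dV_measure M N)"
proof (cases "a \<le> b")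
  case True
  then show ?thesis
    unfolding sets_dV_measure using assms by (intro sigma_sets.Basic) auto
qed simp

lemma Ioi_eq_Union_Ioc: "{t<..} = (\<Union>n. {t<..t + real n})" for t :: real
proof (intro equalityI subsetI)
  fix x assume "x \<in> {t<..}"
  moreover obtain n :: nat where "x - t \<le> real n" using real_arch_simple by blast
  ultimately show "x \<in> (\<Union>n. {t<..t + real n})" by (auto intro!: exI[of _ n])
qed auto

lemma Ioi_0_eq_Union_Ioc: "{0<..} = (\<Union>n. {1 / Suc n<..real (Suc n)})"
proof (intro equalityI subsetI)
  fix x :: real assume x: "x \<in> {0<..}"
  obtain m :: nat where m: "x \<le> real m" using real_arch_simple by blast
  obtain k :: nat where k: "1 / x < real k" using reals_Archimedean2 by blast
  have "1 / Suc (m + k) < x" using k x by (auto simp: field_simps) (smt (verit) mult_nonneg_nonneg of_nat_0_le_iff)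
  then show "x \<in> (\<Union>n. {1 / Suc n<..real (Suc n)})" using m by (auto intro!: exI[of _ "m + k"])
qed (auto intro: less_trans[rotated])

lemma measurable_id_dV_measure:
  "(\<lambda>t. t) \<in> borel_measurable (dV_measure M N)"
proof (rule borel_measurableI_greater)
  fix a :: real
  have *: "{a<..} \<in> sets (dV_measure M N)" if "0 < a" for a
    unfolding Ioi_eq_Union_Ioc using that by (intro sets.countable_UN) (auto intro: Ioc_in_sets_dV_measure)
  show "{x \<in> space (dV_measure M N). a < x} \<in> sets (dV_measure M N)"
  proof (cases "0 < a")
    case True
    then have "{x \<in> space (dV_measure M N). a < x} = {a<..}" by (auto simp: space_dV_measure)
    then show ?thesis using * True by simp
  next
    case False
    then have "{x \<in> space (dV_measure M N). a < x} = space (dV_measure M N)"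
      by (auto simp: space_dV_measure)
    then show ?thesis by (metis sets.top)
  qed
qed

lemma borel_measurable_dV_measure:
  "f \<in> borel_measurable borel \<Longrightarrow> f \<in> borel_measurable (dV_measure M N)"
  using measurable_compose[OF measurable_id_dV_measure] by blast

lemma Ioi_in_sets_dV_measure:
  assumes "0 \<le> t"
  shows "{t<..} \<in> sets (dV_measure M N)"
proof -
  have "{x \<in> space (dV_measure M N). t < x} \<in> sets (dV_measure M N)"
    using measurable_id_dV_measure by measurable
  also have "{x \<in> space (dV_measure M N). t < x} = {t<..}"
    using assms by (auto simp: space_dV_measure)
  finally show ?thesis .
qed

text \<open>The identity under \<open>|dV\<^sub>N|\<close> has tail \<open>V\<^sub>N\<close>.\<close>

lemma emeasure_dV_measure_Ioi:
  assumes N: "Young_Orlicz N" and t: "0 < t"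
  shows "emeasure (dV_measure M N) {t<..} = V_fun M N t"
proof (rule LIMSEQ_unique)
  have "(\<lambda>n. emeasure (dV_measure M N) {t<..t + real n}) \<longlonglongrightarrow> emeasure (dV_measure M N) (\<Union>n. {t<..t + real n})"
    using t by (intro Lim_emeasure_incseq) (auto simp: incseq_def intro: Ioc_in_sets_dV_measure)
  then show "(\<lambda>n. V_fun M N t - V_fun M N (t + real n)) \<longlonglongrightarrow> emeasure (dV_measure M N) {t<..}"
    using t by (simp add: emeasure_dV_measure[OF N] Ioi_eq_Union_Ioc[symmetric])
  have "filterlim (\<lambda>n. t + real n) at_top sequentially"
    by (intro filterlim_tendsto_add_at_top[OF tendsto_const] filterlim_real_sequentially)
  then have "(\<lambda>n. V_fun M N (t + real n)) \<longlonglongrightarrow> 0"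
    by (rule filterlim_compose[OF V_fun_tendsto_0[OF N]])
  then have "(\<lambda>n. V_fun M N t - V_fun M N (t + real n)) \<longlonglongrightarrow> V_fun M N t - 0"
    using V_fun_finite[OF N t] by (intro tendsto_diff_ennreal tendsto_const) (auto simp: less_top)
  then show "(\<lambda>n. V_fun M N t - V_fun M N (t + real n)) \<longlonglongrightarrow> V_fun M N t" by simp
qed

lemma emeasure_dV_measure_finite:
  assumes "Young_Orlicz N" "0 < a"
  shows "emeasure (dV_measure M N) {a<..b} < \<infinity>"
proof -
  have "emeasure (dV_measure M N) {a<..b} \<le> emeasure (dV_measure M N) {a<..}"
    using assms by (intro emeasure_mono Ioi_in_sets_dV_measure) auto
  then show ?thesis
    using V_fun_finite[OF assms] 
    unfolding emeasure_dV_measure_Ioi[OF assms] by (rule order.strict_trans1)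
qed

lemma sigma_finite_dV_measure:
  assumes N: "Young_Orlicz N"
  shows "sigma_finite_measure (dV_measure M N)"
proof
  show "\<exists>A. countable A \<and> A \<subseteq> sets (dV_measure M N) \<and> \<Union>A = space (dV_measure M N) \<and> (\<forall>a\<in>A. emeasure (dV_measure M N) a \<noteq> \<infinity>)"
    using emeasure_dV_measure_finite[OF N, of _ M]
    by (intro exI[of _ "range (\<lambda>n. {1 / Suc n<..real (Suc n)})"])
       (auto simp: space_dV_measure Ioi_0_eq_Union_Ioc less_top simp del: of_nat_Suc intro!: Ioc_in_sets_dV_measure)
qed

text \<open>This is what leaves room in \<open>X\<close> for a copy of a step function on \<open>((0, \<infinity>), |dV\<^sub>N|)\<close>.\<close>

lemma emeasure_space_dV_measure_le:
  assumes N: "Young_Orlicz N"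
  shows "emeasure (dV_measure M N) {0<..} \<le> emeasure M (space M)"
proof -
  have "1 / real (Suc (Suc n)) \<le> 1 / real (Suc n)" for n by (simp add: field_simps)
  then have inc: "incseq (\<lambda>n. {1 / Suc n<..real (Suc n)})"
    by (intro incseq_SucI Ioc_subset_iff[THEN iffD2] disjI2 conjI) auto
  have "emeasure (dV_measure M N) {0<..} = (SUP n. emeasure (dV_measure M N) {1 / Suc n<..real (Suc n)})"
    unfolding Ioi_0_eq_Union_Ioc using inc
    by (intro SUP_emeasure_incseq[symmetric]) (auto simp del: of_nat_Suc intro!: Ioc_in_sets_dV_measure)
  also have "\<dots> \<le> emeasure M (space M)"
  proof (rule SUP_least)
    fix n
    have "emeasure (dV_measure M N) {1 / Suc n<..real (Suc n)} \<le> emeasure (dV_measure M N) {1 / Suc n<..}"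
      by (intro emeasure_mono Ioi_in_sets_dV_measure) auto
    also have "\<dots> \<le> emeasure M (space M)"
      by (subst emeasure_dV_measure_Ioi[OF N]) (auto simp: V_fun_def)
    finally show "emeasure (dV_measure M N) {1 / Suc n<..real (Suc n)} \<le> emeasure M (space M)" .
  qed
  finally show ?thesis .
qed

lemma emeasure_dV_measure_N_greater:
  assumes N: "Young_Orlicz N" and "0 < C" "0 < s"
  shows "emeasure (dV_measure M N) {t \<in> space (dV_measure M N). N s < N (C * t)} = V_fun M N (s / C)"
proof -
  have "{t \<in> space (dV_measure M N). N s < N (C * t)} = {s / C<..}"
  proof (rule set_eqI)
    fix t :: real
    show "t \<in> {t \<in> space (dV_measure M N). N s < N (C * t)} \<longleftrightarrow> t \<in> {s / C<..}"
    proof (cases "0 < t")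
      case True
      then show ?thesis using assms by (auto simp: space_dV_measure Young_Orlicz_less_iff field_simps)
    next
      case False
      moreover have "0 < s / C" using assms by simp
      ultimately show ?thesis by (auto simp: space_dV_measure)
    qed
  qed
  then show ?thesis using assms by (simp add: emeasure_dV_measure_Ioi)
qed

section \<open>Finite integral implies equivalence\<close>

text \<open>
  The admissible constants in the weak norm form an up-set, because \<open>V\<^sub>N\<close> is non-increasing; so every
  constant above the infimum is admissible.
\<close>

lemma weak_norm_tail_le:
  assumes N: "Young_Orlicz N" and K: "weak_norm M N f < ennreal K" and t: "0 < t"
  shows "tail_fun M f t \<le> V_fun M N (t / K)"
proof -
  obtain k where k: "0 < k" "\<And>t. 0 < t \<Longrightarrow> tail_fun M f t \<le> V_fun M N (t / k)" "ennreal k < ennreal K"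
    using K unfolding weak_norm_def INF_less_iff by auto
  then have kK: "k < K" by (simp add: ennreal_less_iff)
  have "tail_fun M f t \<le> V_fun M N (t / k)" using k(2) t .
  also have "\<dots> \<le> V_fun M N (t / K)"
    using k(1) kK t by (intro V_fun_antimono[OF N]) (auto intro!: divide_left_mono)
  finally show ?thesis .
qed

text \<open>
  This makes the denominator in the ratio of the norms positive: if all \<open>K > 0\<close> are admissible, the tail of
  \<open>f\<close> at \<open>t\<close> is below \<open>V\<^sub>N (t / K)\<close>, which tends to \<open>0\<close> as \<open>K\<close> tends to \<open>0\<close>.
\<close>

lemma weak_norm_eq_0_imp_AE_0:
  assumes N: "Young_Orlicz N" and f [measurable]: "f \<in> borel_measurable M" and "weak_norm M N f = 0"
  shows "AE x in M. f x = 0"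
proof -
  have "tail_fun M f t \<le> 0" if t: "0 < t" for t
  proof (rule tendsto_lowerbound)
    have "filterlim (\<lambda>n. t * real (Suc n)) at_top sequentially"
      using t by (intro filterlim_tendsto_pos_mult_at_top[OF tendsto_const] filterlim_compose[OF filterlim_real_sequentially filterlim_Suc])
    then show "(\<lambda>n. V_fun M N (t * real (Suc n))) \<longlonglongrightarrow> 0"
      by (rule filterlim_compose[OF V_fun_tendsto_0[OF N]])
    have "tail_fun M f t \<le> V_fun M N (t * real (Suc n))" for n
      using weak_norm_tail_le[OF N, of M f "1 / Suc n" t] assms(3) t by simp
    then show "\<forall>\<^sub>F n in sequentially. tail_fun M f t \<le> V_fun M N (t * real (Suc n))" by simp
  qed simp
  then have "AE x in M. \<bar>f x\<bar> < 1 / Suc n" for n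
    unfolding tail_fun_def by (intro AE_I[where N = "{x \<in> space M. 1 / Suc n \<le> \<bar>f x\<bar>}"]) (auto simp: not_less)
  then have "AE x in M. \<forall>n. \<bar>f x\<bar> < 1 / Suc n" by (simp add: AE_all_countable)
  then show ?thesis
  proof (rule AE_mp, intro AE_I2 impI)
    fix x assume "\<forall>n. \<bar>f x\<bar> < 1 / Suc n"
    then show "f x = 0"
      using reals_Archimedean[of "\<bar>f x\<bar>"] by (auto simp: inverse_eq_divide) (meson less_asym)
  qed
qed

lemma nn_integral_le_V_integral:
  assumes M: "sigma_finite_measure M" and N: "Young_Orlicz N"
    and f [measurable]: "f \<in> borel_measurable M"
    and K: "0 < K" "\<And>t. 0 < t \<Longrightarrow> tail_fun M f t \<le> V_fun M N (t / K)" and C: "0 < C"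
  shows "(\<integral>\<^sup>+ x. ennreal (N (C * (\<bar>f x\<bar> / K))) \<partial>M) \<le> V_integral M N C"
  unfolding V_integral_def
proof (rule nn_integral_mono_tails[OF M _ sigma_finite_dV_measure[OF N]])
  note [measurable] = Young_Orlicz_measurable[OF N]
  show "(\<lambda>x. N (C * (\<bar>f x\<bar> / K))) \<in> borel_measurable M" by measurable
  show "(\<lambda>t. N (C * t)) \<in> borel_measurable (dV_measure M N)"
    by (rule borel_measurable_dV_measure) measurable
  fix u :: real assume "0 < u"
  then obtain s where s: "0 < s" "N s = u" by (rule Young_Orlicz_inverse[OF N])
  have "emeasure M {x \<in> space M. u < N (C * (\<bar>f x\<bar> / K))} \<le> tail_fun M f (K * (s / C))"
    unfolding tail_fun_def
  proof (intro emeasure_mono subsetI)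
    fix x assume x: "x \<in> {x \<in> space M. u < N (C * (\<bar>f x\<bar> / K))}"
    then have "s < C * (\<bar>f x\<bar> / K)"
      using Young_Orlicz_less_iff[OF N, of s "C * (\<bar>f x\<bar> / K)"] s C K by auto
    then show "x \<in> {x \<in> space M. K * (s / C) \<le> \<bar>f x\<bar>}" using x C K(1) by (auto simp: field_simps)
  qed measurable
  also have "\<dots> \<le> V_fun M N (s / C)"
    using K(2)[of "K * (s / C)"] K(1) s(1) C by simp
  also have "\<dots> = emeasure (dV_measure M N) {t \<in> space (dV_measure M N). u < N (C * t)}"
    using emeasure_dV_measure_N_greater[OF N C s(1), of M] s(2) by simp
  finally show "emeasure M {x \<in> space M. u < N (C * (\<bar>f x\<bar> / K))} \<le> \<dots>" .
qed

text \<open>By convexity \<open>N (e C t) \<le> e N (C t)\<close> for \<open>0 \<le> e \<le> 1\<close>, so scaling \<open>C\<close> down scales the integral down.\<close>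

lemma V_integral_le_1:
  assumes N: "Young_Orlicz N" and C: "0 < C" and fin: "V_integral M N C < \<infinity>"
  obtains c where "0 < c" "V_integral M N c \<le> 1"
proof -
  note [measurable] = Young_Orlicz_measurable[OF N]
  obtain r where r: "0 \<le> r" "V_integral M N C = ennreal r"
    using fin by (metis ennreal_cases infinity_ennreal_def less_irrefl)
  define e where "e = 1 / (r + 1)"
  have e: "0 < e" "e \<le> 1" "e * r \<le> 1" using r(1) by (auto simp: e_def)
  have "V_integral M N (e * C) \<le> (\<integral>\<^sup>+ t. ennreal e * ennreal (N (C * t)) \<partial>dV_measure M N)"
    unfolding V_integral_def
    using Young_Orlicz_scale[OF N, of e] e N
    by (intro nn_integral_mono) (auto simp: ennreal_mult[symmetric] Young_Orlicz_def mult.assoc intro!: ennreal_leI)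
  also have "\<dots> = ennreal e * V_integral M N C"
    unfolding V_integral_def
    by (rule nn_integral_cmult) (intro measurable_compose[OF _ measurable_ennreal] borel_measurable_dV_measure, measurable)
  also have "\<dots> \<le> 1" using e r by (simp add: ennreal_mult[symmetric])
  finally show thesis using that[of "e * C"] e C by simp
qed

lemma Y_const_finite:
  assumes M: "sigma_finite_measure M" and N: "Young_Orlicz N"
    and C: "0 < C" "V_integral M N C < \<infinity>"
  shows "Y_const M N < \<infinity>"
proof -
  obtain c where c: "0 < c" "V_integral M N c \<le> 1"
    using V_integral_le_1[OF N C] .
  have "Y_const M N \<le> ennreal (1 / c)"
    unfolding Y_const_def
  proof (rule SUP_least)
    fix f assume "f \<in> {f \<in> weak_Orlicz M N. \<not> (AE x in M. f x = 0)}"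
    then have f: "f \<in> borel_measurable M" "weak_norm M N f < \<infinity>" "weak_norm M N f \<noteq> 0"
      using weak_norm_eq_0_imp_AE_0[OF N, of f M] by (auto simp: weak_Orlicz_def)
    then obtain w where w: "0 < w" "weak_norm M N f = ennreal w"
      by (metis ennreal_cases ennreal_eq_0_iff infinity_ennreal_def less_irrefl not_less)
    \<comment> \<open>The infimum \<open>w\<close> itself is only reached as the limit of the admissible constants \<open>K > w\<close>.\<close>
    have "strong_norm M N f \<le> ennreal (K / c)" if K: "w < K" for K
      unfolding strong_norm_def
    proof (rule INF_lower)
      have "(\<integral>\<^sup>+ x. ennreal (N (c * (\<bar>f x\<bar> / K))) \<partial>M) \<le> V_integral M N c"
        using K w c f by (intro nn_integral_le_V_integral[OF M N] weak_norm_tail_le[OF N]) (auto simp: ennreal_less_iff)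
      also note c(2)
      finally show "K / c \<in> {k. 0 < k \<and> (\<integral>\<^sup>+ x. ennreal (N (\<bar>f x\<bar> / k)) \<partial>M) \<le> 1}"
        using K w c by (simp add: mult.commute)
    qed
    then have "strong_norm M N f \<le> ennreal (w / c)"
      by (intro tendsto_lowerbound[where F = "at_right w" and f = "\<lambda>K. ennreal (K / c)"])
         (use c in \<open>auto intro!: tendsto_intros simp: eventually_at_right_less eventually_at_filter\<close>)
    also have "\<dots> = ennreal (1 / c) * weak_norm M N f"
      using w c by (simp add: ennreal_mult[symmetric])
    finally show "strong_norm M N f / weak_norm M N f \<le> ennreal (1 / c)"
      using w by (subst divide_le_posI_ennreal) (auto simp: mult.commute)
  qed
  then show ?thesis by (simp add: le_less_trans)
qed

section \<open>Infinite integrals: a dyadic extremal function\<close>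

text \<open>
  All integer powers of two, indexed by \<open>nat\<close> because the sets that will carry these values
  are constructed one after the other.
\<close>

definition dyadic :: "nat \<Rightarrow> real" where
  "dyadic n = 2 powr real_of_int (int_decode n)"

lemma dyadic_pos: "0 < dyadic n" by (simp add: dyadic_def)

lemma mem_dyadic_Ioc_iff:
  "s \<in> {dyadic n<..2 * dyadic n} \<longleftrightarrow> 0 < s \<and> \<lceil>log 2 s\<rceil> = int_decode n + 1"
proof (cases "0 < s")
  case True
  have "2 * dyadic n = 2 powr (real_of_int (int_decode n) + 1)" by (simp add: dyadic_def powr_add)
  then have "s \<in> {dyadic n<..2 * dyadic n} \<longleftrightarrow> real_of_int (int_decode n) < log 2 s \<and> log 2 s \<le> real_of_int (int_decode n) + 1"
    using True by (simp add: dyadic_def less_log_iff log_le_iff)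
  then show ?thesis using True by (auto simp: ceiling_eq_iff)
next
  case False
  then show ?thesis using dyadic_pos[of n] by auto
qed

lemma disjoint_dyadic_Ioc: "disjoint_family (\<lambda>n. {dyadic n<..2 * dyadic n})"
  unfolding disjoint_family_on_def disjoint_iff mem_dyadic_Ioc_iff by (auto dest: injD[OF inj_int_decode])

lemma ex_dyadic_Ioc:
  assumes "0 < s"
  obtains n where "s \<in> {dyadic n<..2 * dyadic n}"
proof
  show "s \<in> {dyadic (int_encode (\<lceil>log 2 s\<rceil> - 1))<..2 * dyadic (int_encode (\<lceil>log 2 s\<rceil> - 1))}"
    using assms unfolding mem_dyadic_Ioc_iff by simp
qed

text \<open>
  The function takes the value \<open>2\<^sup>j\<close> on a set whose measure is the \<open>|dV\<^sub>N|\<close>-mass of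
  \<open>(2\<^sup>j, 2\<^sup>j\<^sup>+\<^sup>1]\<close>. It is a copy of the map \<open>q\<close> on \<open>(0, \<infinity>)\<close> sending \<open>s\<close> to the largest power of two below \<open>s\<close>,
  and \<open>s / 2 \<le> q s < s\<close> gives the two tail bounds.
\<close>

lemma ex_function_with_tail_near_V_fun:
  assumes M: "atomless M" and N: "Young_Orlicz N"
  shows "\<exists>f. f \<in> borel_measurable M \<and> (\<forall>x. 0 \<le> f x) \<and>
    (\<forall>t>0. emeasure M {x \<in> space M. t \<le> f x} \<le> V_fun M N t) \<and>
    (\<forall>t>0. V_fun M N (2 * t) \<le> emeasure M {x \<in> space M. t < f x})"
proof -
  let ?L = "dV_measure M N" and ?D = "\<lambda>n. {dyadic n<..2 * dyadic n}"
  have D: "?D n \<in> sets ?L" for n by (rule Ioc_in_sets_dV_measure[OF dyadic_pos])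
  have "(\<Sum>n. emeasure ?L (?D n)) = emeasure ?L (\<Union>n. ?D n)"
    using D by (intro suminf_emeasure disjoint_dyadic_Ioc) auto
  also have "\<dots> \<le> emeasure ?L {0<..}"
    using dyadic_pos by (intro emeasure_mono Ioi_in_sets_dV_measure) (auto intro: less_trans)
  also have "\<dots> \<le> emeasure M (space M)" by (rule emeasure_space_dV_measure_le[OF N])
  finally have le: "(\<Sum>n. emeasure ?L (?D n)) \<le> emeasure M (space M)" .
  obtain A where A: "\<And>n. A n \<in> sets M" "disjoint_family A" "\<And>n. emeasure M (A n) = emeasure ?L (?D n)"
    using atomless_disjoint_sets_of_measures[OF M emeasure_dV_measure_finite[OF N dyadic_pos] le] by blast
  have transport: "emeasure M (\<Union>n\<in>I. A n) = emeasure ?L (\<Union>n\<in>I. ?D n)" for I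
  proof -
    have "emeasure M (\<Union>n\<in>I. A n) = (\<integral>\<^sup>+ n. emeasure M (A n) \<partial>count_space I)"
      using A(1) by (intro emeasure_UN_countable disjoint_family_on_mono[OF _ A(2)]) auto
    also have "\<dots> = (\<integral>\<^sup>+ n. emeasure ?L (?D n) \<partial>count_space I)"
      by (simp only: A(3))
    also have "\<dots> = emeasure ?L (\<Union>n\<in>I. ?D n)"
      using D by (intro emeasure_UN_countable[symmetric] disjoint_family_on_mono[OF _ disjoint_dyadic_Ioc]) auto
    finally show ?thesis .
  qed
  \<comment> \<open>The sets \<open>A n\<close> are disjoint, so \<open>LEAST\<close> only selects the unique index.\<close>
  define f where "f x = (if x \<in> (\<Union>n. A n) then dyadic (LEAST n. x \<in> A n) else 0)" for x
  have f_eq: "f x = dyadic n" if "x \<in> A n" for x n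
  proof -
    have "(LEAST n. x \<in> A n) = n"
      using that A(2) LeastI[of "\<lambda>n. x \<in> A n" n] unfolding disjoint_family_on_def by blast
    then show ?thesis using that by (auto simp: f_def)
  qed
  have f_0: "f x = 0" if "x \<notin> (\<Union>n. A n)" for x using that by (simp add: f_def)
  have sub: "A n \<subseteq> space M" for n using A(1) by (rule sets.sets_into_space)
  \<comment> \<open>Only conditions that exclude the value \<open>0\<close> are covered: \<open>f\<close> vanishes outside the sets \<open>A n\<close>,
    a part of the space that has no counterpart on \<open>(0, \<infinity>)\<close>.\<close>
  have preimage: "{x \<in> space M. Q (f x)} = (\<Union>n\<in>{n. Q (dyadic n)}. A n)" if "\<not> Q 0" for Q
  proof (intro equalityI subsetI)
    fix x assume x: "x \<in> {x \<in> space M. Q (f x)}"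
    then have "x \<in> (\<Union>n. A n)" using f_0[of x] that by (cases "x \<in> (\<Union>n. A n)") auto
    then obtain n where "x \<in> A n" by blast
    with x f_eq[of x n] show "x \<in> (\<Union>n\<in>{n. Q (dyadic n)}. A n)" by auto
  next
    fix x assume "x \<in> (\<Union>n\<in>{n. Q (dyadic n)}. A n)"
    then obtain n where "Q (dyadic n)" "x \<in> A n" by blast
    with f_eq[of x n] sub[of n] show "x \<in> {x \<in> space M. Q (f x)}" by auto
  qed
  show ?thesis
  proof (intro exI[of _ f] conjI allI impI)
    show nonneg: "0 \<le> f x" for x by (simp add: f_def dyadic_pos less_imp_le)
    show "f \<in> borel_measurable M"
    proof (rule borel_measurableI_greater)
      fix t
      show "{x \<in> space M. t < f x} \<in> sets M"
      proof (cases "0 \<le> t")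
        case True
        then show ?thesis using A(1) preimage[of "\<lambda>y. t < y"] by auto
      next
        case False
        then have "t < f x" for x using nonneg[of x] by linarith
        then have "{x \<in> space M. t < f x} = space M" by auto
        then show ?thesis by simp
      qed
    qed
    fix t :: real assume t: "0 < t"
    have "emeasure M {x \<in> space M. t \<le> f x} = emeasure ?L (\<Union>n\<in>{n. t \<le> dyadic n}. ?D n)"
      using t by (subst preimage) (auto simp: transport)
    also have "\<dots> \<le> emeasure ?L {t<..}"
      using t by (intro emeasure_mono Ioi_in_sets_dV_measure) auto
    finally show "emeasure M {x \<in> space M. t \<le> f x} \<le> V_fun M N t"
      by (simp add: emeasure_dV_measure_Ioi[OF N t])
    have "V_fun M N (2 * t) = emeasure ?L {2 * t<..}"
      using t by (simp add: emeasure_dV_measure_Ioi[OF N])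
    also have "\<dots> \<le> emeasure ?L (\<Union>n\<in>{n. t < dyadic n}. ?D n)"
    proof (intro emeasure_mono subsetI)
      fix s assume s: "s \<in> {2 * t<..}"
      then have "0 < s" using t by simp
      then obtain n where "s \<in> ?D n" by (rule ex_dyadic_Ioc)
      with s show "s \<in> (\<Union>n\<in>{n. t < dyadic n}. ?D n)" by (auto intro!: exI[of _ n])
    qed (use D in auto)
    also have "\<dots> = emeasure M {x \<in> space M. t < f x}"
      using t by (subst preimage) (auto simp: transport)
    finally show "V_fun M N (2 * t) \<le> emeasure M {x \<in> space M. t < f x}" .
  qed
qed

lemma V_integral_le_nn_integral:
  assumes M: "sigma_finite_measure M" and N: "Young_Orlicz N"
    and f [measurable]: "f \<in> borel_measurable M" "\<And>x. 0 \<le> f x"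
    and tail: "\<And>t. 0 < t \<Longrightarrow> V_fun M N (2 * t) \<le> emeasure M {x \<in> space M. t < f x}" and C: "0 < C"
  shows "V_integral M N C \<le> (\<integral>\<^sup>+ x. ennreal (N (2 * C * f x)) \<partial>M)"
  unfolding V_integral_def
proof (rule nn_integral_mono_tails[OF sigma_finite_dV_measure[OF N] _ M])
  note [measurable] = Young_Orlicz_measurable[OF N]
  show "(\<lambda>x. N (2 * C * f x)) \<in> borel_measurable M" by measurable
  show "(\<lambda>t. N (C * t)) \<in> borel_measurable (dV_measure M N)"
    by (rule borel_measurable_dV_measure) measurable
  fix u :: real assume "0 < u"
  then obtain s where s: "0 < s" "N s = u" by (rule Young_Orlicz_inverse[OF N])
  have "emeasure (dV_measure M N) {t \<in> space (dV_measure M N). u < N (C * t)} = V_fun M N (2 * (s / (2 * C)))"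
    using emeasure_dV_measure_N_greater[OF N C s(1), of M] s(2) by simp
  also have "\<dots> \<le> emeasure M {x \<in> space M. s / (2 * C) < f x}"
    using s C by (intro tail) auto
  also have "{x \<in> space M. s / (2 * C) < f x} = {x \<in> space M. u < N (2 * C * f x)}"
    using Young_Orlicz_less_iff[OF N, of s] s C f(2) by (auto simp: field_simps)
  finally show "emeasure (dV_measure M N) {t \<in> space (dV_measure M N). u < N (C * t)}
    \<le> emeasure M {x \<in> space M. u < N (2 * C * f x)}" .
qed

lemma Y_const_infinite:
  assumes M: "sigma_finite_measure M" "atomless M" and N: "Young_Orlicz N"
    and inf: "\<And>C. 0 < C \<Longrightarrow> V_integral M N C = \<infinity>"
  shows "Y_const M N = \<infinity>"
proof -
  obtain f where f: "f \<in> borel_measurable M" "\<And>x. 0 \<le> f x"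
    "\<And>t. 0 < t \<Longrightarrow> emeasure M {x \<in> space M. t \<le> f x} \<le> V_fun M N t"
    "\<And>t. 0 < t \<Longrightarrow> V_fun M N (2 * t) \<le> emeasure M {x \<in> space M. t < f x}"
    using ex_function_with_tail_near_V_fun[OF M(2) N] by blast
  have "weak_norm M N f \<le> ennreal 1"
    unfolding weak_norm_def using f(2,3) by (intro INF_lower) (auto simp: tail_fun_def)
  then have weak: "weak_norm M N f \<le> 1" by simp
  have infinite: "(\<integral>\<^sup>+ x. ennreal (N (\<bar>f x\<bar> / k)) \<partial>M) = \<infinity>" if "0 < k" for k
    \<comment> \<open>The factor \<open>2\<close> lost in the tail of \<open>f\<close> is absorbed by taking \<open>C = 1 / (2 k)\<close>.\<close>
    using V_integral_le_nn_integral[OF M(1) N f(1,2,4), of "1 / (2 * k)"] inf[of "1 / (2 * k)"] that f(2)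
    by (simp add: top_unique)
  then have "{k. 0 < k \<and> (\<integral>\<^sup>+ x. ennreal (N (\<bar>f x\<bar> / k)) \<partial>M) \<le> 1} = {}"
    by (auto simp: top_unique)
  then have strong: "strong_norm M N f = \<infinity>"
    unfolding strong_norm_def by (simp only: image_empty Inf_empty) simp
  have "\<not> (AE x in M. f x = 0)"
  proof
    assume "AE x in M. f x = 0"
    then have "(\<integral>\<^sup>+ x. ennreal (N (\<bar>f x\<bar> / 1)) \<partial>M) = (\<integral>\<^sup>+ x. 0 \<partial>M)"
      by (intro nn_integral_cong_AE) (auto simp: Young_Orlicz_zero[OF N])
    then show False using infinite[of 1] by simp
  qed
  then have "strong_norm M N f / weak_norm M N f \<le> Y_const M N"
    unfolding Y_const_def using f(1) weak by (intro SUP_upper) (auto simp: weak_Orlicz_def intro: le_less_trans)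
  moreover have "strong_norm M N f / weak_norm M N f = \<infinity>"
    using weak strong by (auto simp: divide_ennreal_def ennreal_top_mult ennreal_inverse_eq_0_iff top_unique)
  ultimately show ?thesis by (simp add: top_unique)
qed

theorem theorem2p1:
  fixes M :: "'a measure" and N :: "real \<Rightarrow> real"
  assumes "sigma_finite_measure M"
    and "atomless M"
    and "emeasure M (space M) \<noteq> 0"
    and "Young_Orlicz N"
  shows "(Y_const M N < \<infinity> \<longleftrightarrow> J_const M N < \<infinity>) \<and>
         (Y_const M N < \<infinity> \<longleftrightarrow> (\<exists>C>0. V_integral M N C < \<infinity>))"
proof -
  have "J_const M N < \<infinity> \<longleftrightarrow> (\<exists>C>0. V_integral M N C < \<infinity>)"
    by (auto simp: J_const_def INF_less_iff)
  moreover have "Y_const M N < \<infinity> \<longleftrightarrow> (\<exists>C>0. V_integral M N C < \<infinity>)"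
  proof
    assume fin: "Y_const M N < \<infinity>"
    show "\<exists>C>0. V_integral M N C < \<infinity>"
    proof (rule ccontr)
      assume "\<not> ?thesis"
      then have "V_integral M N C = \<infinity>" if "0 < C" for C
        using that by (metis infinity_ennreal_def top.not_eq_extremum)
      then have "Y_const M N = \<infinity>" using assms by (intro Y_const_infinite)
      with fin show False by simp
    qed
  next
    assume "\<exists>C>0. V_integral M N C < \<infinity>"
    then show "Y_const M N < \<infinity>" using Y_const_finite[OF assms(1,4)] by blast
  qed
  ultimately show ?thesis by blast
qed

end
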